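(* Let $\mathcal{H}$ be a separable Hilbert space, let $\Psi=\{\psi_i\}_{i\in I}$ and $\Phi=\{\phi_i\}_{i\in I}$ be frames for $\mathcal{H}$, let $U\in\mathcal{B}(\mathcal{H})$ be an invertible operator, and suppose that the operator $\mathbf{G}_{U,\Phi,\Psi}$ on $\ell^2(I)$ has closed range. Then: (1) There exists a unique dual $\Phi^{(U,\Psi)}$ of $\Phi$ such that $\left(\mathbf{G}_{U,\Phi,\Psi}\right)^{\dagger}=\mathbf{G}_{U^{-1},\widetilde{\Psi},\Phi^{(U,\Psi)}}$. (2) There exists a unique dual $\Psi^{\overline{(U,\Phi)}}$ of $\Psi$ such that $\left(\mathbf{G}_{U,\Phi,\Psi}\right)^{\dagger}=\mathbf{G}_{U^{-1},\Psi^{\overline{(U,\Phi)}},\widetilde{\Phi}}$.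
   Context: All Hilbert spaces are separable, $I$ is a countable index set, $\ell^2=\ell^2(I)$, and $\mathcal{B}(\mathcal{H})$ is the set of bounded linear operators on $\mathcal{H}$. A sequence $\Phi=\{\phi_i\}_{i\in I}$ in $\mathcal{H}$ is a Bessel sequence with Bessel bound $B_\Phi>0$ if $\sum_{i}|\langle f,\phi_i\rangle|^2\le B_\Phi\|f\|^2$ for all $f\in\mathcal{H}$, and a frame for $\mathcal{H}$ if moreover $A_\Phi\|f\|^2\le\sum_i|\langle f,\phi_i\rangle|^2$ for some $A_\Phi>0$ and all $f$. For a Bessel sequence, $T_\Phi:\ell^2\to\mathcal{H}$, $T_\Phi\{c_i\}=\sum_i c_i\phi_i$, is the synthesis operator, with adjoint $T_\Phi^*f=\{\langle f,\phi_i\rangle\}_{i}$, and $S_\Phi=T_\Phi T_\Phi^*$ is the frame operator (invertible if $\Phi$ is a frame). A dual of a Bessel sequence $\Phi$ is a Bessel sequence $\Phi^d=\{\phi^d_i\}$ in $\mathcal{H}$ with $f=\sum_i\langle f,\phi_i^d\rangle\phi_i$ for all $f\in\mathcal{H}$; the canonical dual of a frame $\Phi$ is $\widetilde\Phi=\{S_\Phi^{-1}\phi_i\}_{i}$. For Bessel sequences $\Phi$ in $\mathcal{H}_2$, $\Psi$ in $\mathcal{H}_1$ and bounded $U:\mathcal{H}_1\to\mathcal{H}_2$, the $U$-cross Gram matrix is $(\mathbf{G}_{U,\Phi,\Psi})_{i,j}=\langle U\psi_j,\phi_i\rangle$, equivalently the bounded operator $\mathbf{G}_{U,\Phi,\Psi}=T_\Phi^*UT_\Psi$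 on $\ell^2$. For a bounded operator $O$ with closed range, $O^\dagger$ denotes its Moore–Penrose pseudo-inverse: the unique bounded operator with $\ker O^\dagger=(\operatorname{ran}O)^\perp$, $\operatorname{ran}O^\dagger=(\ker O)^\perp$, $OO^\dagger O=O$. *)

theory Defs
  imports "HOL-Analysis.Analysis"
begin

section \<open>Complex Hilbert spaces\<close>

text \<open>The inner product is linear in its first argument, as required by
  \<open>f = \<Sum>\<^sub>i \<langle>f, \<phi>\<^sub>i\<^sup>d\<rangle> \<phi>\<^sub>i\<close>. Positive definiteness of \<open>cinner\<close> is contained
  in the last axiom together with the norm axioms of the parent class.\<close>

class complex_inner = real_normed_vector +
  fixes scaleC :: "complex \<Rightarrow> 'a \<Rightarrow> 'a" (infixr "*\<^sub>C" 75)
    and cinner :: "'a \<Rightarrow> 'a \<Rightarrow> complex"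
  assumes scaleC_add_right: "a *\<^sub>C (x + y) = a *\<^sub>C x + a *\<^sub>C y"
    and scaleC_add_left: "(a + b) *\<^sub>C x = a *\<^sub>C x + b *\<^sub>C x"
    and scaleC_scaleC: "a *\<^sub>C b *\<^sub>C x = (a * b) *\<^sub>C x"
    and scaleR_scaleC: "r *\<^sub>R x = complex_of_real r *\<^sub>C x"
    and cinner_commute: "cinner x y = cnj (cinner y x)"
    and cinner_add_left: "cinner (x + y) z = cinner x z + cinner y z"
    and cinner_scaleC_left: "cinner (a *\<^sub>C x) y = a * cinner x y"
    and cinner_self: "cinner x x = complex_of_real ((norm x)\<^sup>2)"

lemma cinner_add_right: "cinner x (y + z) = cinner x y + cinner x (z :: 'a::complex_inner)"
  by (metis cinner_add_left cinner_commute complex_cnj_add)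

lemma cinner_scaleC_right: "cinner x (a *\<^sub>C y) = cnj a * cinner x (y :: 'a::complex_inner)"
  by (metis cinner_scaleC_left cinner_commute complex_cnj_mult)

lemma norm_scaleC: "norm (a *\<^sub>C x) = cmod a * norm (x :: 'a::complex_inner)"
proof -
  have "complex_of_real ((norm (a *\<^sub>C x))\<^sup>2) = complex_of_real ((cmod a * norm x)\<^sup>2)"
    unfolding cinner_self[symmetric] cinner_scaleC_left cinner_scaleC_right
    using complex_norm_square[of a] by (simp add: cinner_self power_mult_distrib mult_ac)
  then have "(norm (a *\<^sub>C x))\<^sup>2 = (cmod a * norm x)\<^sup>2"
    by (simp only: of_real_eq_iff)
  then show ?thesis by (simp add: power2_eq_iff_nonneg)
qed

lemma cinner_zero_left [simp]: "cinner 0 (y :: 'a::complex_inner) = 0"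
  using cinner_add_left[of 0 0 y] by simp

lemma norm_cinner_le: "cmod (cinner x y) \<le> norm x * norm (y :: 'a::complex_inner)"
proof (cases "y = 0")
  case True
  then show ?thesis by (metis cinner_commute cinner_zero_left complex_cnj_zero norm_zero mult_zero_right order_refl)
next
  case False
  define n where "n = (norm y)\<^sup>2"
  have n: "n > 0" using False by (simp add: n_def)
  define a where "a = - cinner x y"
  define w where "w = complex_of_real n *\<^sub>C x + a *\<^sub>C y"
  have "complex_of_real ((norm w)\<^sup>2) = cinner w w" by (simp add: cinner_self)
  also have "\<dots> = complex_of_real n * (complex_of_real n * cinner x x)
        + complex_of_real n * (cnj a * cinner x y) + a * (complex_of_real n * cinner y x)
        + a * (cnj a * cinner y y)"
    unfolding w_def
    by (simp add: cinner_add_left cinner_add_right cinner_scaleC_left cinner_scaleC_right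
        algebra_simps)
  also have "cinner x x = complex_of_real ((norm x)\<^sup>2)" by (rule cinner_self)
  also have "cinner y y = complex_of_real n" unfolding n_def by (rule cinner_self)
  also have "cinner y x = - cnj a" by (simp add: a_def cinner_commute[of y x])
  also have "cinner x y = - a" by (simp add: a_def)
  also have "complex_of_real n * (complex_of_real n * complex_of_real ((norm x)\<^sup>2))
        + complex_of_real n * (cnj a * - a) + a * (complex_of_real n * - cnj a)
        + a * (cnj a * complex_of_real n)
      = complex_of_real n * (complex_of_real n * complex_of_real ((norm x)\<^sup>2)) - complex_of_real n * (a * cnj a)"
    by (simp add: algebra_simps)
  also have "\<dots> = complex_of_real (n * (n * (norm x)\<^sup>2 - (cmod a)\<^sup>2))"
    by (simp add: complex_norm_square[symmetric] algebra_simps)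
  finally have "(norm w)\<^sup>2 = n * (n * (norm x)\<^sup>2 - (cmod a)\<^sup>2)"
    by (simp only: of_real_eq_iff)
  then have "0 \<le> n * (n * (norm x)\<^sup>2 - (cmod a)\<^sup>2)" by (metis zero_le_power2)
  then have "(cmod (cinner x y))\<^sup>2 \<le> (norm x * norm y)\<^sup>2"
    using n by (simp add: zero_le_mult_iff a_def n_def power_mult_distrib mult.commute)
  then show ?thesis by (rule power2_le_imp_le) simp
qed

lemma bounded_linear_cinner_left: "bounded_linear (\<lambda>x. cinner x (y :: 'a::complex_inner))"
  by (rule bounded_linear_intro[of _ "norm y"])
    (auto simp: cinner_add_left cinner_scaleC_left scaleR_scaleC norm_cinner_le scaleR_conv_of_real)

class chilbert_space = complex_inner + complete_space

instance chilbert_space \<subseteq> banach ..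

definition bounded_clinear :: "('a::complex_inner \<Rightarrow> 'b::complex_inner) \<Rightarrow> bool" where
  "bounded_clinear f \<longleftrightarrow> bounded_linear f \<and> (\<forall>a x. f (a *\<^sub>C x) = a *\<^sub>C f x)"

definition invertible_op :: "('a::complex_inner \<Rightarrow> 'b::complex_inner) \<Rightarrow> bool" where
  "invertible_op U \<longleftrightarrow> bounded_clinear U \<and>
     (\<exists>V. bounded_clinear V \<and> (\<forall>x. V (U x) = x) \<and> (\<forall>y. U (V y) = y))"

definition ker :: "('a \<Rightarrow> 'b::zero) \<Rightarrow> 'a set" where
  "ker f = {x. f x = 0}"

definition orth_compl :: "'a::complex_inner set \<Rightarrow> 'a set" where
  "orth_compl S = {x. \<forall>y\<in>S. cinner x y = 0}"

definition is_pseudo_inverse ::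
  "('a::complex_inner \<Rightarrow> 'b::complex_inner) \<Rightarrow> ('b \<Rightarrow> 'a) \<Rightarrow> bool" where
  "is_pseudo_inverse S P \<longleftrightarrow> bounded_clinear P \<and>
     ker P = orth_compl (range S) \<and> range P = orth_compl (ker S) \<and> S \<circ> P \<circ> S = S"

text \<open>Meaningful for bounded \<open>S\<close> with closed range; unspecified otherwise.\<close>

definition pseudo_inverse :: "('a::complex_inner \<Rightarrow> 'b::complex_inner) \<Rightarrow> 'b \<Rightarrow> 'a" where
  "pseudo_inverse S = (THE P. is_pseudo_inverse S P)"


section \<open>Square-summable families\<close>

typedef 'i ell2 = "{c :: 'i \<Rightarrow> complex. (\<lambda>i. (cmod (c i))\<^sup>2) summable_on UNIV}"
  morphisms ell2_coeff Abs_ell2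
  by (rule exI[of _ "\<lambda>_. 0"]) simp

lemma ell2_eqI: "(\<And>i. ell2_coeff x i = ell2_coeff y i) \<Longrightarrow> x = y"
  by (metis ell2_coeff_inject ext)

lemma ell2_coeff_summable: "(\<lambda>i. (cmod (ell2_coeff x i))\<^sup>2) summable_on UNIV"
  using ell2_coeff by blast

lemma square_summable_iff_L2_set_bounded:
  "(\<lambda>i. (cmod (c i))\<^sup>2) summable_on UNIV \<longleftrightarrow>
     (\<exists>K. \<forall>F. finite F \<longrightarrow> L2_set (\<lambda>i. cmod (c i)) F \<le> K)"
proof
  assume s: "(\<lambda>i. (cmod (c i))\<^sup>2) summable_on UNIV"
  have "L2_set (\<lambda>i. cmod (c i)) F \<le> sqrt (\<Sum>\<^sub>\<infinity>i. (cmod (c i))\<^sup>2)" if "finite F" for F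
    unfolding L2_set_def
    by (intro real_sqrt_le_mono finite_sum_le_infsum[OF s that]) auto
  then show "\<exists>K. \<forall>F. finite F \<longrightarrow> L2_set (\<lambda>i. cmod (c i)) F \<le> K" by blast
next
  assume "\<exists>K. \<forall>F. finite F \<longrightarrow> L2_set (\<lambda>i. cmod (c i)) F \<le> K"
  then obtain K where K: "\<And>F. finite F \<Longrightarrow> L2_set (\<lambda>i. cmod (c i)) F \<le> K" by blast
  have "(\<Sum>i\<in>F. (cmod (c i))\<^sup>2) \<le> K\<^sup>2" if "finite F" for F
    using power_mono[OF K[OF that] L2_set_nonneg, of 2]
    by (simp add: L2_set_def sum_nonneg)
  then show "(\<lambda>i. (cmod (c i))\<^sup>2) summable_on UNIV"
    by (intro nonneg_bdd_above_summable_on bdd_aboveI[of _ "K\<^sup>2"]) auto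
qed

lemma square_summable_add:
  assumes "(\<lambda>i. (cmod (c i))\<^sup>2) summable_on UNIV" "(\<lambda>i. (cmod (d i))\<^sup>2) summable_on UNIV"
  shows "(\<lambda>i. (cmod (c i + d i))\<^sup>2) summable_on UNIV"
proof -
  obtain K L where K: "\<And>F. finite F \<Longrightarrow> L2_set (\<lambda>i. cmod (c i)) F \<le> K"
    and L: "\<And>F. finite F \<Longrightarrow> L2_set (\<lambda>i. cmod (d i)) F \<le> L"
    using assms unfolding square_summable_iff_L2_set_bounded by blast
  have "L2_set (\<lambda>i. cmod (c i + d i)) F \<le> K + L" if "finite F" for F
  proof -
    have "L2_set (\<lambda>i. cmod (c i + d i)) F \<le> L2_set (\<lambda>i. cmod (c i) + cmod (d i)) F"
      by (intro L2_set_mono norm_triangle_ineq) auto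
    also have "\<dots> \<le> L2_set (\<lambda>i. cmod (c i)) F + L2_set (\<lambda>i. cmod (d i)) F"
      by (rule L2_set_triangle_ineq)
    finally show ?thesis using K[OF that] L[OF that] by linarith
  qed
  then show ?thesis unfolding square_summable_iff_L2_set_bounded by blast
qed

lemma square_summable_scale:
  assumes "(\<lambda>i. (cmod (c i))\<^sup>2) summable_on UNIV"
  shows "(\<lambda>i. (cmod (a * c i))\<^sup>2) summable_on UNIV"
  using summable_on_cmult_right[OF assms, of "(cmod a)\<^sup>2"]
  by (simp add: norm_mult power_mult_distrib)

lemma square_summable_prod:
  assumes "(\<lambda>i. (cmod (c i))\<^sup>2) summable_on UNIV" "(\<lambda>i. (cmod (d i))\<^sup>2) summable_on UNIV"
  shows "(\<lambda>i. c i * cnj (d i)) summable_on UNIV"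
proof -
  have "(\<lambda>i. norm (c i * cnj (d i))) summable_on UNIV"
  proof (rule abs_summable_product)
    show "(\<lambda>i. norm (c i * c i)) summable_on UNIV"
      using assms(1) by (simp add: norm_mult power2_eq_square)
    show "(\<lambda>i. norm (cnj (d i) * cnj (d i))) summable_on UNIV"
      using assms(2) by (simp add: norm_mult power2_eq_square)
  qed
  then show ?thesis by (rule abs_summable_summable)
qed

instantiation ell2 :: (type) complex_inner
begin

definition "0 = Abs_ell2 (\<lambda>_. 0)"
definition "x + y = Abs_ell2 (\<lambda>i. ell2_coeff x i + ell2_coeff y i)"
definition "- x = Abs_ell2 (\<lambda>i. - ell2_coeff x i)"
definition "x - y = Abs_ell2 (\<lambda>i. ell2_coeff x i - ell2_coeff y i)"
definition "a *\<^sub>C x = Abs_ell2 (\<lambda>i. a * ell2_coeff x i)"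
definition "r *\<^sub>R (x :: 'a ell2) = complex_of_real r *\<^sub>C x"
definition "cinner x y = (\<Sum>\<^sub>\<infinity>i. ell2_coeff x i * cnj (ell2_coeff y i))"
definition "norm x = sqrt (\<Sum>\<^sub>\<infinity>i. (cmod (ell2_coeff x i))\<^sup>2)"
definition "dist x y = norm (x - y :: 'a ell2)"
definition "sgn x = inverse (norm x) *\<^sub>R (x :: 'a ell2)"
definition [code del]:
  "(uniformity :: ('a ell2 \<times> 'a ell2) filter) = (INF e\<in>{0<..}. principal {(x, y). dist x y < e})"
definition [code del]:
  "open S \<longleftrightarrow> (\<forall>x\<in>S. \<forall>\<^sub>F (x', y) in uniformity. x' = x \<longrightarrow> y \<in> (S :: 'a ell2 set))"

lemma ell2_coeff_zero [simp]: "ell2_coeff 0 i = 0"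
  by (simp add: zero_ell2_def Abs_ell2_inverse)

lemma ell2_coeff_add [simp]: "ell2_coeff (x + y) i = ell2_coeff x i + ell2_coeff y i"
  by (simp add: plus_ell2_def Abs_ell2_inverse square_summable_add ell2_coeff_summable)

lemma ell2_coeff_scaleC [simp]: "ell2_coeff (a *\<^sub>C x) i = a * ell2_coeff x i"
  by (simp add: scaleC_ell2_def Abs_ell2_inverse square_summable_scale ell2_coeff_summable)

lemma ell2_coeff_uminus [simp]: "ell2_coeff (- x) i = - ell2_coeff x i"
  by (simp add: uminus_ell2_def Abs_ell2_inverse ell2_coeff_summable)

lemma ell2_coeff_minus [simp]: "ell2_coeff (x - y) i = ell2_coeff x i - ell2_coeff y i"
  using square_summable_add[OF ell2_coeff_summable[of x] ell2_coeff_summable[of "- y"]]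
  by (simp add: minus_ell2_def Abs_ell2_inverse)

lemma ell2_coeff_scaleR [simp]: "ell2_coeff (r *\<^sub>R x) i = complex_of_real r * ell2_coeff x i"
  by (simp add: scaleR_ell2_def)

lemma L2_set_le_norm_ell2: "finite F \<Longrightarrow> L2_set (\<lambda>i. cmod (ell2_coeff x i)) F \<le> norm x"
  unfolding L2_set_def norm_ell2_def
  by (intro real_sqrt_le_mono finite_sum_le_infsum ell2_coeff_summable) auto

lemma norm_ell2_leI:
  assumes "\<And>F. finite F \<Longrightarrow> L2_set (\<lambda>i. cmod (ell2_coeff x i)) F \<le> K"
  shows "norm x \<le> K"
proof -
  have K0: "0 \<le> K" using assms[of "{}"] by simp
  have "(\<Sum>i\<in>F. (cmod (ell2_coeff x i))\<^sup>2) \<le> K\<^sup>2" if "finite F" for F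
    using power_mono[OF assms[OF that] L2_set_nonneg, of 2]
    by (simp add: L2_set_def sum_nonneg)
  then have "(\<Sum>\<^sub>\<infinity>i. (cmod (ell2_coeff x i))\<^sup>2) \<le> K\<^sup>2"
    by (intro infsum_le_finite_sums ell2_coeff_summable) auto
  then show ?thesis unfolding norm_ell2_def using K0 by (simp add: real_le_lsqrt infsum_nonneg)
qed

lemma norm_ell2_coeff_le: "cmod (ell2_coeff x i) \<le> norm x"
  using L2_set_le_norm_ell2[of "{i}" x] by simp

instance
proof
  fix x y z :: "'a ell2" and a b :: complex and r s :: real
  show "x + y + z = x + (y + z)" "x + y = y + x" "0 + x = x" "- x + x = 0" "x - y = x + - y"
    by (auto intro!: ell2_eqI)
  show "r *\<^sub>R (x + y) = r *\<^sub>R x + r *\<^sub>R y" "(r + s) *\<^sub>R x = r *\<^sub>R x + s *\<^sub>R x"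
    "r *\<^sub>R s *\<^sub>R x = (r * s) *\<^sub>R x" "1 *\<^sub>R x = x"
    by (auto intro!: ell2_eqI simp: algebra_simps)
  show "dist x y = norm (x - y)" by (rule dist_ell2_def)
  show "sgn x = inverse (norm x) *\<^sub>R x" by (rule sgn_ell2_def)
  show "(uniformity :: ('a ell2 \<times> 'a ell2) filter) = (INF e\<in>{0<..}. principal {(x, y). dist x y < e})"
    by (rule uniformity_ell2_def)
  show "open S \<longleftrightarrow> (\<forall>x\<in>S. \<forall>\<^sub>F (x', y) in uniformity. x' = x \<longrightarrow> y \<in> S)" for S :: "'a ell2 set"
    by (rule open_ell2_def)
  show "norm x = 0 \<longleftrightarrow> x = 0"
  proof
    assume "norm x = 0"
    then have "ell2_coeff x i = 0" for i using norm_ell2_coeff_le[of x i] by simp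
    then show "x = 0" by (auto intro: ell2_eqI)
  qed (simp add: norm_ell2_def)
  show "norm (x + y) \<le> norm x + norm y"
  proof (rule norm_ell2_leI)
    fix F :: "'a set" assume F: "finite F"
    have "L2_set (\<lambda>i. cmod (ell2_coeff (x + y) i)) F
        \<le> L2_set (\<lambda>i. cmod (ell2_coeff x i) + cmod (ell2_coeff y i)) F"
      by (intro L2_set_mono) (auto intro: norm_triangle_ineq)
    also have "\<dots> \<le> L2_set (\<lambda>i. cmod (ell2_coeff x i)) F + L2_set (\<lambda>i. cmod (ell2_coeff y i)) F"
      by (rule L2_set_triangle_ineq)
    finally show "L2_set (\<lambda>i. cmod (ell2_coeff (x + y) i)) F \<le> norm x + norm y"
      using L2_set_le_norm_ell2[OF F, of x] L2_set_le_norm_ell2[OF F, of y] by linarith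
  qed
  show "norm (r *\<^sub>R x) = \<bar>r\<bar> * norm x"
    by (simp add: norm_ell2_def norm_mult power_mult_distrib infsum_cmult_right' real_sqrt_mult)
  show "a *\<^sub>C (x + y) = a *\<^sub>C x + a *\<^sub>C y" "(a + b) *\<^sub>C x = a *\<^sub>C x + b *\<^sub>C x"
    "a *\<^sub>C b *\<^sub>C x = (a * b) *\<^sub>C x" "r *\<^sub>R x = complex_of_real r *\<^sub>C x"
    by (auto intro!: ell2_eqI simp: algebra_simps)
  show "cinner x y = cnj (cinner y x)"
    by (simp add: cinner_ell2_def infsum_cnj[symmetric] mult.commute del: infsum_cnj)
  show "cinner (x + y) z = cinner x z + cinner y z"
    by (simp add: cinner_ell2_def distrib_right infsum_add square_summable_prod ell2_coeff_summable)
  show "cinner (a *\<^sub>C x) y = a * cinner x y"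
    by (simp add: cinner_ell2_def mult.assoc infsum_cmult_right')
  have "cinner x x = (\<Sum>\<^sub>\<infinity>i. complex_of_real ((cmod (ell2_coeff x i))\<^sup>2))"
    by (simp add: cinner_ell2_def complex_norm_square[symmetric])
  also have "\<dots> = complex_of_real (\<Sum>\<^sub>\<infinity>i. (cmod (ell2_coeff x i))\<^sup>2)"
    using infsumI[OF has_sum_of_real[OF has_sum_infsum[OF ell2_coeff_summable[of x]]]] by simp
  also have "\<dots> = complex_of_real ((norm x)\<^sup>2)"
    by (simp add: norm_ell2_def infsum_nonneg)
  finally show "cinner x x = complex_of_real ((norm x)\<^sup>2)" .
qed

end

instance ell2 :: (type) chilbert_space
proof
  fix X :: "nat \<Rightarrow> 'a ell2"
  assume C: "Cauchy X"
  have "Cauchy (\<lambda>n. ell2_coeff (X n) i)" for i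
  proof (rule metric_CauchyI)
    fix e :: real assume "e > 0"
    then obtain M where M: "\<And>m n. m \<ge> M \<Longrightarrow> n \<ge> M \<Longrightarrow> dist (X m) (X n) < e"
      using C unfolding Cauchy_def by blast
    have "dist (ell2_coeff (X m) i) (ell2_coeff (X n) i) \<le> dist (X m) (X n)" for m n
      using norm_ell2_coeff_le[of "X m - X n" i] by (simp add: dist_norm)
    then show "\<exists>M. \<forall>m\<ge>M. \<forall>n\<ge>M. dist (ell2_coeff (X m) i) (ell2_coeff (X n) i) < e"
      using M by (meson le_less_trans)
  qed
  then have "\<forall>i. \<exists>l. (\<lambda>n. ell2_coeff (X n) i) \<longlonglongrightarrow> l"
    by (simp add: Cauchy_convergent_iff convergent_def)
  then obtain l where l: "\<And>i. (\<lambda>n. ell2_coeff (X n) i) \<longlonglongrightarrow> l i" by metis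
  have lim: "L2_set (\<lambda>i. cmod (ell2_coeff (X m) i - l i)) F \<le> e"
    if M: "\<And>n. n \<ge> M \<Longrightarrow> dist (X m) (X n) \<le> e" and F: "finite F" for M m e F
  proof (rule tendsto_upperbound)
    show "(\<lambda>n. L2_set (\<lambda>i. cmod (ell2_coeff (X m) i - ell2_coeff (X n) i)) F)
        \<longlonglongrightarrow> L2_set (\<lambda>i. cmod (ell2_coeff (X m) i - l i)) F"
      unfolding L2_set_def by (intro tendsto_intros l)
    have "L2_set (\<lambda>i. cmod (ell2_coeff (X m) i - ell2_coeff (X n) i)) F \<le> e" if "n \<ge> M" for n
      using L2_set_le_norm_ell2[OF F, of "X m - X n"] M[OF that] by (simp add: dist_norm)
    then show "\<forall>\<^sub>F n in sequentially.
        L2_set (\<lambda>i. cmod (ell2_coeff (X m) i - ell2_coeff (X n) i)) F \<le> e"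
      by (auto simp: eventually_sequentially)
  qed auto
  obtain M where M: "\<And>m n. m \<ge> M \<Longrightarrow> n \<ge> M \<Longrightarrow> dist (X m) (X n) < 1"
    using C unfolding Cauchy_def by (meson zero_less_one)
  have "(\<lambda>i. (cmod (ell2_coeff (X M) i - l i))\<^sup>2) summable_on UNIV"
    unfolding square_summable_iff_L2_set_bounded
    using lim[of M M 1] M[of M] by (meson less_imp_le order_refl)
  from square_summable_add[OF this ell2_coeff_summable[of "- X M"]]
  have "(\<lambda>i. (cmod (l i))\<^sup>2) summable_on UNIV" by simp
  then have L: "ell2_coeff (Abs_ell2 l) = l" by (simp add: Abs_ell2_inverse)
  have "X \<longlonglongrightarrow> Abs_ell2 l"
  proof (rule metric_LIMSEQ_I)
    fix e :: real assume e: "e > 0"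
    then obtain N where N: "\<And>m n. m \<ge> N \<Longrightarrow> n \<ge> N \<Longrightarrow> dist (X m) (X n) < e / 2"
      using C unfolding Cauchy_def by (meson half_gt_zero)
    have "norm (X m - Abs_ell2 l) \<le> e / 2" if "m \<ge> N" for m
      using lim[of N m "e / 2"] N[OF that]
      by (intro norm_ell2_leI) (simp add: L less_imp_le)
    then show "\<exists>N. \<forall>n\<ge>N. dist (X n) (Abs_ell2 l) < e"
      using e by (intro exI[of _ N]) (force simp: dist_norm)
  qed
  then show "convergent X" by (auto simp: convergent_def)
qed


section \<open>Frames\<close>

definition bessel_bound :: "('i \<Rightarrow> 'a::complex_inner) \<Rightarrow> real \<Rightarrow> bool" where
  "bessel_bound \<Phi> B \<longleftrightarrow> B > 0 \<and>
     (\<forall>f. (\<lambda>i. (cmod (cinner f (\<Phi> i)))\<^sup>2) summable_on UNIV \<and>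
          (\<Sum>\<^sub>\<infinity>i. (cmod (cinner f (\<Phi> i)))\<^sup>2) \<le> B * (norm f)\<^sup>2)"

definition is_bessel :: "('i \<Rightarrow> 'a::complex_inner) \<Rightarrow> bool" where
  "is_bessel \<Phi> \<longleftrightarrow> (\<exists>B. bessel_bound \<Phi> B)"

definition is_frame :: "('i \<Rightarrow> 'a::complex_inner) \<Rightarrow> bool" where
  "is_frame \<Phi> \<longleftrightarrow> is_bessel \<Phi> \<and>
     (\<exists>A>0. \<forall>f. A * (norm f)\<^sup>2 \<le> (\<Sum>\<^sub>\<infinity>i. (cmod (cinner f (\<Phi> i)))\<^sup>2))"

definition synthesis :: "('i \<Rightarrow> 'a::complex_inner) \<Rightarrow> 'i ell2 \<Rightarrow> 'a" where
  "synthesis \<Phi> c = (\<Sum>\<^sub>\<infinity>i. ell2_coeff c i *\<^sub>C \<Phi> i)"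

text \<open>\<open>T\<^sub>\<Phi>\<^sup>*\<close>, given by its explicit formula; that it is the adjoint of \<open>T\<^sub>\<Phi>\<close> is
  \<open>cinner_synthesis\<close> below. The argument of \<open>Abs_ell2\<close> is square summable when
  \<open>\<Phi>\<close> is a Bessel sequence.\<close>

definition analysis :: "('i \<Rightarrow> 'a::complex_inner) \<Rightarrow> 'a \<Rightarrow> 'i ell2" where
  "analysis \<Phi> f = Abs_ell2 (\<lambda>i. cinner f (\<Phi> i))"

definition frame_op :: "('i \<Rightarrow> 'a::complex_inner) \<Rightarrow> 'a \<Rightarrow> 'a" where
  "frame_op \<Phi> = synthesis \<Phi> \<circ> analysis \<Phi>"

definition is_dual :: "('i \<Rightarrow> 'a::complex_inner) \<Rightarrow> ('i \<Rightarrow> 'a) \<Rightarrow> bool" where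
  "is_dual \<Phi> \<Phi>d \<longleftrightarrow> is_bessel \<Phi> \<and> is_bessel \<Phi>d \<and>
     (\<forall>f. ((\<lambda>i. cinner f (\<Phi>d i) *\<^sub>C \<Phi> i) has_sum f) UNIV)"

definition canonical_dual :: "('i \<Rightarrow> 'a::complex_inner) \<Rightarrow> 'i \<Rightarrow> 'a" where
  "canonical_dual \<Phi> i = inv (frame_op \<Phi>) (\<Phi> i)"

text \<open>As an operator on sequences; its matrix entries are computed in
  \<open>cross_gram_entry\<close> below.\<close>

definition cross_gram :: "('a \<Rightarrow> 'b) \<Rightarrow> ('i \<Rightarrow> 'b::complex_inner) \<Rightarrow> ('i \<Rightarrow> 'a::complex_inner) \<Rightarrow>
    'i ell2 \<Rightarrow> 'i ell2" where
  "cross_gram U \<Phi> \<Psi> = analysis \<Phi> \<circ> U \<circ> synthesis \<Psi>"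

lemma ell2_coeff_analysis:
  assumes "is_bessel \<Phi>"
  shows "ell2_coeff (analysis \<Phi> f) i = cinner f (\<Phi> i)"
  using assms unfolding analysis_def is_bessel_def bessel_bound_def
  by (subst Abs_ell2_inverse) auto

lemma bessel_norm_sum_le:
  fixes \<Phi> :: "'i \<Rightarrow> 'a::complex_inner"
  assumes B: "bessel_bound \<Phi> B" and F: "finite F"
  shows "norm (\<Sum>i\<in>F. c i *\<^sub>C \<Phi> i) \<le> sqrt B * L2_set (\<lambda>i. cmod (c i)) F"
proof -
  define v where "v = (\<Sum>i\<in>F. c i *\<^sub>C \<Phi> i)"
  have "cinner v v = (\<Sum>i\<in>F. c i * cinner (\<Phi> i) v)"
    unfolding v_def[symmetric]
    by (subst (1) v_def)
      (simp add: linear_sum[OF bounded_linear.linear[OF bounded_linear_cinner_left]] cinner_scaleC_left)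
  then have "(norm v)\<^sup>2 = cmod (\<Sum>i\<in>F. c i * cinner (\<Phi> i) v)"
    by (metis cinner_self norm_of_real abs_power2)
  also have "\<dots> \<le> (\<Sum>i\<in>F. \<bar>cmod (c i)\<bar> * \<bar>cmod (cinner v (\<Phi> i))\<bar>)"
    by (rule order_trans[OF norm_sum])
      (simp add: norm_mult cinner_commute[of "\<Phi> _" v])
  also have "\<dots> \<le> L2_set (\<lambda>i. cmod (c i)) F * L2_set (\<lambda>i. cmod (cinner v (\<Phi> i))) F"
    by (rule L2_set_mult_ineq)
  finally have 1: "(norm v)\<^sup>2 \<le>
      L2_set (\<lambda>i. cmod (c i)) F * L2_set (\<lambda>i. cmod (cinner v (\<Phi> i))) F" .
  have "L2_set (\<lambda>i. cmod (cinner v (\<Phi> i))) F \<le> sqrt (B * (norm v)\<^sup>2)"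
    unfolding L2_set_def using B F
    by (intro real_sqrt_le_mono order_trans[OF finite_sum_le_infsum])
      (auto simp: bessel_bound_def)
  also have "\<dots> = sqrt B * norm v" by (simp add: real_sqrt_mult)
  finally have "norm v * norm v \<le> L2_set (\<lambda>i. cmod (c i)) F * (sqrt B * norm v)"
    using order_trans[OF 1 mult_left_mono[OF _ L2_set_nonneg]] by (simp add: power2_eq_square)
  then have "norm v * norm v \<le> (sqrt B * L2_set (\<lambda>i. cmod (c i)) F) * norm v"
    by (simp add: mult_ac)
  then show ?thesis
    using B unfolding v_def[symmetric] bessel_bound_def
    by (cases "v = 0") (auto simp: L2_set_nonneg)
qed

lemma synthesis_summable:
  fixes \<Phi> :: "'i \<Rightarrow> 'a::chilbert_space"
  assumes "is_bessel \<Phi>"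
  shows "(\<lambda>i. ell2_coeff c i *\<^sub>C \<Phi> i) summable_on UNIV"
proof -
  obtain B where B: "bessel_bound \<Phi> B" using assms by (auto simp: is_bessel_def)
  then have B0: "B > 0" by (simp add: bessel_bound_def)
  define f where "f i = ell2_coeff c i *\<^sub>C \<Phi> i" for i
  define q where "q i = (cmod (ell2_coeff c i))\<^sup>2" for i
  have q: "q summable_on UNIV" unfolding q_def by (rule ell2_coeff_summable)
  have "\<exists>P. eventually P (finite_subsets_at_top UNIV) \<and>
          (\<forall>F F'. P F \<and> P F' \<longrightarrow> dist (sum f F) (sum f F') < e)" if e: "e > 0" for e
  proof -
    define d where "d = (e / 3)\<^sup>2 / B"
    have d: "d > 0" using e B0 by (simp add: d_def)
    obtain F0 where F0: "finite F0" "dist (sum q F0) (infsum q UNIV) \<le> d"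
      using infsum_finite_approximation[OF q d] by blast
    have near: "dist (sum f F) (sum f F0) \<le> e / 3" if F: "finite F" "F0 \<subseteq> F" for F
    proof -
      have "sum q (F - F0) = sum q F - sum q F0" using F by (simp add: sum_diff)
      also have "\<dots> \<le> infsum q UNIV - sum q F0"
        using finite_sum_le_infsum[OF q F(1)] by (simp add: q_def)
      also have "\<dots> \<le> d" using F0(2) by (simp add: dist_real_def)
      finally have qd: "sum q (F - F0) \<le> d" .
      have "dist (sum f F) (sum f F0) = norm (sum f (F - F0))"
        using F by (simp add: sum_diff dist_norm)
      also have "\<dots> \<le> sqrt B * L2_set (\<lambda>i. cmod (ell2_coeff c i)) (F - F0)"
        unfolding f_def using bessel_norm_sum_le[OF B] F(1) by blast
      also have "\<dots> = sqrt (B * sum q (F - F0))"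
        by (simp add: L2_set_def q_def real_sqrt_mult)
      also have "\<dots> \<le> sqrt (B * d)"
        using qd B0 by (intro real_sqrt_le_mono mult_left_mono) auto
      also have "\<dots> = e / 3" using e B0 by (simp add: d_def)
      finally show ?thesis .
    qed
    have "eventually (\<lambda>F. finite F \<and> F0 \<subseteq> F) (finite_subsets_at_top UNIV)"
      using F0(1) by (auto simp: eventually_finite_subsets_at_top)
    moreover have "dist (sum f F) (sum f F') < e"
      if "finite F \<and> F0 \<subseteq> F" "finite F' \<and> F0 \<subseteq> F'" for F F'
      using near[of F] near[of F'] that e dist_triangle2[of "sum f F" "sum f F'" "sum f F0"]
      by linarith
    ultimately show ?thesis by blast
  qed
  then have "cauchy_filter (filtermap (sum f) (finite_subsets_at_top UNIV))"
    by (simp add: cauchy_filter_metric_filtermap)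
  moreover have "complete (UNIV :: 'a set)"
    by (meson Cauchy_convergent UNIV_I complete_def convergent_def)
  ultimately obtain L where "(sum f \<longlongrightarrow> L) (finite_subsets_at_top UNIV)"
    using complete_uniform[where S = UNIV] by (force simp: filterlim_def)
  then show ?thesis unfolding f_def[abs_def] summable_on_def has_sum_def by blast
qed

lemma cinner_synthesis:
  fixes \<Phi> :: "'i \<Rightarrow> 'a::chilbert_space"
  assumes "is_bessel \<Phi>"
  shows "cinner (synthesis \<Phi> c) f = cinner c (analysis \<Phi> f)"
proof -
  have "((\<lambda>i. cinner (ell2_coeff c i *\<^sub>C \<Phi> i) f) has_sum cinner (synthesis \<Phi> c) f) UNIV"
    unfolding synthesis_def
    by (rule has_sum_bounded_linear[OF bounded_linear_cinner_left
          has_sum_infsum[OF synthesis_summable[OF assms]]])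
  then show ?thesis
    by (simp add: cinner_ell2_def ell2_coeff_analysis[OF assms] cinner_scaleC_left
        cinner_commute[of f] infsumI)
qed

lemma cross_gram_entry:
  fixes \<Phi> :: "'i \<Rightarrow> 'b::chilbert_space" and \<Psi> :: "'i \<Rightarrow> 'a::chilbert_space"
  assumes \<Phi>: "is_bessel \<Phi>" and \<Psi>: "is_bessel \<Psi>" and U: "bounded_clinear U"
  shows "((\<lambda>j. cinner (U (\<Psi> j)) (\<Phi> i) * ell2_coeff c j) has_sum
          ell2_coeff (cross_gram U \<Phi> \<Psi> c) i) UNIV"
proof -
  have "bounded_linear (\<lambda>x. cinner (U x) (\<Phi> i))"
    using bounded_linear_compose[OF bounded_linear_cinner_left] U
    by (auto simp: bounded_clinear_def)
  from has_sum_bounded_linear[OF this has_sum_infsum[OF synthesis_summable[OF \<Psi>, of c]]]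
  show ?thesis
    using U by (simp add: cross_gram_def ell2_coeff_analysis[OF \<Phi>] synthesis_def
        bounded_clinear_def cinner_scaleC_left mult.commute)
qed

end

theory Submission
  imports Defs
begin

text \<open>
  Write \<open>T\<^sub>\<Phi>\<close> for synthesis, \<open>T\<^sub>\<Phi>\<^sup>*\<close> for analysis, \<open>S\<^sub>\<Phi> = T\<^sub>\<Phi> T\<^sub>\<Phi>\<^sup>*\<close> for the frame operator
  and \<open>\<Phi>~\<close> for the canonical dual, so that the cross Gram operator is
  \<open>G = T\<^sub>\<Phi>\<^sup>* U T\<^sub>\<Psi>\<close>. For frames, \<open>T\<^sub>\<Psi>\<close> is onto and \<open>T\<^sub>\<Phi>\<^sup>*\<close> is one-to-one, so \<open>ker G = ker T\<^sub>\<Psi>\<close> and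
  \<open>(ran G)\<^sup>\<bottom> = ker T\<^sub>\<Phi>\<close>. The operator \<open>P = T\<^bsub>\<Psi>~\<^esub>\<^sup>* U\<^sup>-\<^sup>1 T\<^bsub>\<Phi>~\<^esub>\<close> built from the two canonical duals has
  exactly the kernel and range demanded of \<open>G\<^sup>\<dagger>\<close>, because \<open>T\<^bsub>\<Phi>~\<^esub> = S\<^sub>\<Phi>\<^sup>-\<^sup>1 T\<^sub>\<Phi>\<close> and
  \<open>T\<^bsub>\<Psi>~\<^esub>\<^sup>* = T\<^sub>\<Psi>\<^sup>* S\<^sub>\<Psi>\<^sup>-\<^sup>1\<close> differ from \<open>T\<^sub>\<Phi>\<close> and \<open>T\<^sub>\<Psi>\<^sup>*\<close> by invertible factors only; and \<open>G P G = G\<close>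
  telescopes through \<open>T\<^sub>\<Psi> T\<^bsub>\<Psi>~\<^esub>\<^sup>* = I\<close>, \<open>U U\<^sup>-\<^sup>1 = I\<close> and \<open>T\<^bsub>\<Phi>~\<^esub> T\<^sub>\<Phi>\<^sup>* = I\<close>. Hence
  \<open>G\<^sup>\<dagger> = P\<close> (lemma \<open>pseudo_inverse_cross_gram\<close>), and both duals asked for exist: they are the
  canonical ones.

  For uniqueness, \<open>T\<^bsub>\<Psi>~\<^esub>\<^sup>* U\<^sup>-\<^sup>1\<close> is one-to-one and can be cancelled on the left of
  \<open>T\<^bsub>\<Psi>~\<^esub>\<^sup>* U\<^sup>-\<^sup>1 T\<^sub>X = T\<^bsub>\<Psi>~\<^esub>\<^sup>* U\<^sup>-\<^sup>1 T\<^bsub>\<Phi>~\<^esub>\<close>, while \<open>U\<^sup>-\<^sup>1 T\<^bsub>\<Phi>~\<^esub>\<close> is onto and can be cancelled on the right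
  in the second claim; a Bessel sequence is determined by its synthesis operator as well as by
  its analysis operator.

  The analytic input is that the frame operator is invertible. It is coercive, and a
  coercive bounded operator is inverted by a contraction argument (lemma
  \<open>coercive_imp_invertible_op\<close>).
\<close>

section \<open>Inner products and bounded operators\<close>

lemma cinner_diff_left: "cinner (x - y) z = cinner x z - cinner y (z :: 'a::complex_inner)"
  using cinner_add_left[of "x - y" y z] by (simp add: algebra_simps)

lemma cinner_diff_right: "cinner z (x - y) = cinner z x - cinner z (y :: 'a::complex_inner)"
  using cinner_add_right[of z "x - y" y] by (simp add: algebra_simps)

lemma cinner_self_eq_0_iff: "cinner x x = 0 \<longleftrightarrow> x = (0 :: 'a::complex_inner)"
  by (simp add: cinner_self)

lemma cinner_zero_right: "cinner x (0 :: 'a::complex_inner) = 0"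
  by (metis cinner_commute cinner_zero_left complex_cnj_zero)

lemma cinner_eqI_left:
  assumes "\<And>z. cinner x z = cinner y (z :: 'a::complex_inner)"
  shows "x = y"
proof -
  have "cinner (x - y) (x - y) = 0" by (simp add: cinner_diff_left assms)
  then show ?thesis by (simp add: cinner_self_eq_0_iff)
qed

lemma cinner_eqI_right:
  assumes "\<And>z. cinner z x = cinner z (y :: 'a::complex_inner)"
  shows "x = y"
  by (rule cinner_eqI_left) (simp add: cinner_commute[of x] cinner_commute[of y] assms)

lemma bounded_clinearI:
  fixes f :: "'a::complex_inner \<Rightarrow> 'b::complex_inner"
  assumes "\<And>x y. f (x + y) = f x + f y" and "\<And>a x. f (a *\<^sub>C x) = a *\<^sub>C f x"
    and "\<And>x. norm (f x) \<le> norm x * K"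
  shows "bounded_clinear f"
  unfolding bounded_clinear_def
  by (auto intro!: bounded_linear_intro[of f K] simp: assms scaleR_scaleC)

lemma
  assumes "bounded_clinear f"
  shows bounded_clinear_add: "f (x + y) = f x + f y"
    and bounded_clinear_diff: "f (x - y) = f x - f y"
    and bounded_clinear_zero: "f 0 = 0"
    and bounded_clinear_scaleC: "f (a *\<^sub>C x) = a *\<^sub>C f x"
proof -
  have "linear f" "f (a *\<^sub>C x) = a *\<^sub>C f x"
    using assms by (auto simp: bounded_clinear_def bounded_linear.linear)
  then show "f (x + y) = f x + f y" "f (x - y) = f x - f y" "f 0 = 0" "f (a *\<^sub>C x) = a *\<^sub>C f x"
    by (auto simp: linear_add linear_diff linear_0)
qed

lemma bounded_clinear_comp:
  assumes "bounded_clinear f" "bounded_clinear g"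
  shows "bounded_clinear (f \<circ> g)"
  using assms bounded_linear_compose[of f g] unfolding bounded_clinear_def comp_def by auto

lemma invertible_op_inv:
  assumes "invertible_op U"
  shows "bounded_clinear (inv U)" "inv U (U x) = x" "U (inv U y) = y"
proof -
  from assms obtain V where V: "bounded_clinear V" "\<And>x. V (U x) = x" "\<And>y. U (V y) = y"
    unfolding invertible_op_def by blast
  have "inv U = V" by (rule inv_equality) (rule V)+
  with V show "bounded_clinear (inv U)" "inv U (U x) = x" "U (inv U y) = y" by auto
qed

lemma invertible_op_inv_op:
  assumes "invertible_op U"
  shows "invertible_op (inv U)"
proof -
  have "bounded_clinear U" using assms by (simp add: invertible_op_def)
  with invertible_op_inv[OF assms] show ?thesis unfolding invertible_op_def[of "inv U"] by blast
qed

text \<open>Solving \<open>S f = g\<close> amounts to finding a fixed point of \<open>f \<mapsto> f - t (S f - g)\<close>. For a small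
  step \<open>t > 0\<close> this map is a contraction, since expanding the square and using coercivity gives
  \<open>\<parallel>f - t S f\<parallel>\<^sup>2 \<le> (1 - 2 t A + t\<^sup>2 M\<^sup>2) \<parallel>f\<parallel>\<^sup>2\<close> for any \<open>M\<close> that bounds \<open>S\<close>.\<close>

lemma coercive_imp_invertible_op:
  fixes S :: "'a::chilbert_space \<Rightarrow> 'a"
  assumes S: "bounded_clinear S" and A: "A > 0"
    and coercive: "\<And>f. A * (norm f)\<^sup>2 \<le> Re (cinner (S f) f)"
  shows "invertible_op S"
proof -
  have lower: "A * norm f \<le> norm (S f)" for f
  proof (cases "f = 0")
    case False
    have "A * (norm f)\<^sup>2 \<le> norm (S f) * norm f"
      using coercive[of f] complex_Re_le_cmod[of "cinner (S f) f"] norm_cinner_le[of "S f" f]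
      by linarith
    then show ?thesis using False by (simp add: power2_eq_square)
  qed (simp add: bounded_clinear_zero[OF S])
  obtain K where K: "K > 0" "\<And>f. norm (S f) \<le> norm f * K"
    using bounded_linear.pos_bounded S unfolding bounded_clinear_def by blast
  \<comment> \<open>Enlarging the bound \<open>K\<close> by \<open>A\<close> ensures \<open>A < M\<close> even on the zero space, so that \<open>c\<close>
    below is the root of a positive number.\<close>
  define M where "M = K + A"
  have M: "M > 0" "A < M" using K(1) A by (auto simp: M_def)
  have bound: "norm (S f) \<le> M * norm f" for f
    using add_mono[OF K(2)[of f] mult_nonneg_nonneg[of A "norm f"]] A
    by (simp add: M_def algebra_simps)
  \<comment> \<open>The step that minimises \<open>1 - 2 t A + t\<^sup>2 M\<^sup>2\<close>, and the resulting minimum \<open>c\<^sup>2\<close>.\<close>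
  define t where "t = A / M\<^sup>2"
  define c where "c = sqrt (1 - (A / M)\<^sup>2)"
  have AM: "0 < A / M" "A / M < 1" using A M by auto
  have AM2: "0 < (A / M)\<^sup>2" "(A / M)\<^sup>2 < 1"
    using zero_less_power[OF AM(1)] power_strict_mono[OF AM(2), of 2] AM(1) A M by auto
  have c: "0 \<le> c" "c < 1" "c\<^sup>2 = 1 - (A / M)\<^sup>2" using AM2 by (auto simp: c_def)
  have t0: "t > 0" using A M by (simp add: t_def)
  have tc: "1 - 2 * t * A + t\<^sup>2 * M\<^sup>2 = c\<^sup>2"
    unfolding c(3) t_def using M(1) by (simp add: field_simps power2_eq_square)
  have contr: "norm (f - t *\<^sub>R S f) \<le> c * norm f" for f
  proof -
    let ?s = "cinner (S f) f"
    have "complex_of_real ((norm (f - t *\<^sub>R S f))\<^sup>2)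
        = cinner f f - of_real t * cinner f (S f) - of_real t * ?s
          + of_real t * (of_real t * cinner (S f) (S f))"
      unfolding cinner_self[symmetric]
      by (simp add: cinner_diff_left cinner_diff_right scaleR_scaleC cinner_scaleC_left
          cinner_scaleC_right algebra_simps)
    also have "\<dots> = of_real ((norm f)\<^sup>2 - 2 * t * Re ?s + t\<^sup>2 * (norm (S f))\<^sup>2)"
      by (subst cinner_commute[of f "S f"], subst cinner_self, subst cinner_self)
        (simp add: complex_eq_iff power2_eq_square)
    finally have "(norm (f - t *\<^sub>R S f))\<^sup>2 = (norm f)\<^sup>2 - 2 * t * Re ?s + t\<^sup>2 * (norm (S f))\<^sup>2"
      by (simp only: of_real_eq_iff)
    also have "\<dots> \<le> (norm f)\<^sup>2 - 2 * t * (A * (norm f)\<^sup>2) + t\<^sup>2 * (M * norm f)\<^sup>2"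
      using coercive[of f] bound[of f] t0
      by (intro add_mono diff_mono mult_left_mono power_mono) auto
    also have "\<dots> = (1 - 2 * t * A + t\<^sup>2 * M\<^sup>2) * (norm f)\<^sup>2"
      by (simp add: algebra_simps power_mult_distrib)
    also have "\<dots> = (c * norm f)\<^sup>2" by (simp add: tc power_mult_distrib)
    finally show ?thesis by (rule power2_le_imp_le) (simp add: c)
  qed
  have "\<exists>f. S f = g" for g
  proof -
    have "\<exists>!f. f - t *\<^sub>R (S f - g) = f"
    proof (rule banach_fix_type[OF c(1,2)], intro allI)
      fix x y :: 'a
      have "x - t *\<^sub>R (S x - g) - (y - t *\<^sub>R (S y - g)) = (x - y) - t *\<^sub>R S (x - y)"
        by (simp add: bounded_clinear_diff[OF S] algebra_simps)
      then show "dist (x - t *\<^sub>R (S x - g)) (y - t *\<^sub>R (S y - g)) \<le> c * dist x y"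
        using contr[of "x - y"] by (simp only: dist_norm)
    qed
    then obtain f where "f - t *\<^sub>R (S f - g) = f" by auto
    then have "S f = g" using t0 by simp
    then show ?thesis by blast
  qed
  then obtain V where V: "\<And>g. S (V g) = g" by metis
  have inj: "f = h" if "S f = S h" for f h
    using lower[of "f - h"] that A
    by (simp add: bounded_clinear_diff[OF S] mult_le_0_iff)
  have "bounded_clinear V"
  proof (rule bounded_clinearI)
    show "V (x + y) = V x + V y" for x y
      by (rule inj) (simp add: V bounded_clinear_add[OF S])
    show "V (a *\<^sub>C x) = a *\<^sub>C V x" for a x
      by (rule inj) (simp add: V bounded_clinear_scaleC[OF S])
    show "norm (V x) \<le> norm x * (1 / A)" for x
      using lower[of "V x"] A by (simp add: V field_simps)
  qed
  moreover have "V (S x) = x" for x by (rule inj) (simp add: V)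
  ultimately show ?thesis using S V unfolding invertible_op_def by blast
qed


section \<open>Uniqueness of the pseudo-inverse\<close>

text \<open>A vector of \<open>ran P = (ker S)\<^sup>\<bottom>\<close> that \<open>S\<close> annihilates is orthogonal to itself. Thus
  \<open>S P S = S\<close> forces \<open>P S P = P\<close>, and it makes any two pseudo-inverses agree on \<open>ran S\<close>; on the
  remaining part \<open>y - S P y\<close> of a vector both vanish.\<close>

lemma is_pseudo_inverse_unique:
  assumes S: "bounded_clinear S" and P: "is_pseudo_inverse S P" and Q: "is_pseudo_inverse S Q"
  shows "Q = P"
proof
  fix y
  have Pl: "bounded_clinear P" and Ql: "bounded_clinear Q"
    and ker: "ker P = orth_compl (range S)" "ker Q = orth_compl (range S)"
    and ran: "range P = orth_compl (ker S)" "range Q = orth_compl (ker S)"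
    and SPS: "\<And>x. S (P (S x)) = S x" and SQS: "\<And>x. S (Q (S x)) = S x"
    using P Q by (auto simp: is_pseudo_inverse_def fun_eq_iff)
  have eq: "u = v" if "u \<in> orth_compl (ker S)" "v \<in> orth_compl (ker S)" "S u = S v" for u v
  proof -
    have "u - v \<in> ker S" using that(3) by (simp add: ker_def bounded_clinear_diff[OF S])
    then have "cinner (u - v) (u - v) = 0"
      using that(1,2) by (simp add: orth_compl_def cinner_diff_left)
    then show ?thesis by (simp add: cinner_self_eq_0_iff)
  qed
  have inP: "P z \<in> orth_compl (ker S)" and inQ: "Q z \<in> orth_compl (ker S)" for z
    using ran by auto
  have "P (S (P y)) = P y" by (rule eq[OF inP inP]) (rule SPS)
  then have "y - S (P y) \<in> ker P" by (simp add: ker_def bounded_clinear_diff[OF Pl])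
  then have "y - S (P y) \<in> ker Q" using ker by simp
  then have "Q y = Q (S (P y))" by (simp add: ker_def bounded_clinear_diff[OF Ql])
  also have "\<dots> = P y"
    by (rule eq[OF inQ inP]) (rule SQS)
  finally show "Q y = P y" .
qed

lemma pseudo_inverse_eqI:
  assumes "bounded_clinear S" and "is_pseudo_inverse S P"
  shows "pseudo_inverse S = P"
  unfolding pseudo_inverse_def
  by (rule the_equality, rule assms(2)) (rule is_pseudo_inverse_unique[OF assms])


section \<open>Synthesis and analysis of Bessel sequences\<close>

lemma norm_analysis_sq:
  assumes "is_bessel \<Phi>"
  shows "(norm (analysis \<Phi> f))\<^sup>2 = (\<Sum>\<^sub>\<infinity>i. (cmod (cinner f (\<Phi> i)))\<^sup>2)"
  by (simp add: norm_ell2_def ell2_coeff_analysis[OF assms] infsum_nonneg)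

lemma bounded_clinear_analysis:
  assumes "is_bessel \<Phi>"
  shows "bounded_clinear (analysis \<Phi>)"
proof -
  obtain B where B: "bessel_bound \<Phi> B" using assms by (auto simp: is_bessel_def)
  show ?thesis
  proof (rule bounded_clinearI)
    show "analysis \<Phi> (x + y) = analysis \<Phi> x + analysis \<Phi> y" for x y
      by (rule ell2_eqI) (simp add: ell2_coeff_analysis[OF assms] cinner_add_left)
    show "analysis \<Phi> (a *\<^sub>C x) = a *\<^sub>C analysis \<Phi> x" for a x
      by (rule ell2_eqI) (simp add: ell2_coeff_analysis[OF assms] cinner_scaleC_left)
    show "norm (analysis \<Phi> x) \<le> norm x * sqrt B" for x
    proof (rule power2_le_imp_le)
      show "(norm (analysis \<Phi> x))\<^sup>2 \<le> (norm x * sqrt B)\<^sup>2"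
        using B by (simp add: norm_analysis_sq[OF assms] bessel_bound_def power_mult_distrib
            mult.commute[of _ B])
      show "0 \<le> norm x * sqrt B" using B by (simp add: bessel_bound_def)
    qed
  qed
qed

text \<open>Algebraic laws and boundedness of synthesis are inherited from analysis, its adjoint.\<close>

lemma bounded_clinear_synthesis:
  fixes \<Phi> :: "'i \<Rightarrow> 'a::chilbert_space"
  assumes "is_bessel \<Phi>"
  shows "bounded_clinear (synthesis \<Phi>)"
proof -
  obtain K where K: "\<And>f. norm (analysis \<Phi> f) \<le> norm f * K"
    using bounded_clinear_analysis[OF assms] bounded_linear.bounded
    unfolding bounded_clinear_def by blast
  show ?thesis
  proof (rule bounded_clinearI)
    show "synthesis \<Phi> (x + y) = synthesis \<Phi> x + synthesis \<Phi> y" for x y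
      by (rule cinner_eqI_left) (simp add: cinner_synthesis[OF assms] cinner_add_left)
    show "synthesis \<Phi> (a *\<^sub>C x) = a *\<^sub>C synthesis \<Phi> x" for a x
      by (rule cinner_eqI_left) (simp add: cinner_synthesis[OF assms] cinner_scaleC_left)
    fix c
    let ?v = "synthesis \<Phi> c"
    have "(norm ?v)\<^sup>2 = cmod (cinner c (analysis \<Phi> ?v))"
      by (metis cinner_synthesis[OF assms] cinner_self norm_of_real abs_power2)
    also have "\<dots> \<le> norm c * norm (analysis \<Phi> ?v)" by (rule norm_cinner_le)
    also have "\<dots> \<le> norm c * (norm ?v * K)" by (intro mult_left_mono K) auto
    finally have *: "norm ?v * norm ?v \<le> (norm c * K) * norm ?v"
      by (simp add: power2_eq_square mult_ac)
    show "norm ?v \<le> norm c * \<bar>K\<bar>"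
    proof (cases "?v = 0")
      case False
      then have "norm ?v \<le> norm c * K" using * by simp
      also have "\<dots> \<le> norm c * \<bar>K\<bar>" by (intro mult_left_mono) auto
      finally show ?thesis .
    qed simp
  qed
qed

lemma cinner_analysis:
  fixes \<Phi> :: "'i \<Rightarrow> 'a::chilbert_space"
  assumes "is_bessel \<Phi>"
  shows "cinner (analysis \<Phi> f) c = cinner f (synthesis \<Phi> c)"
  by (metis assms cinner_commute cinner_synthesis)

lemma analysis_injective:
  assumes "is_bessel \<Phi>" "is_bessel X" "\<And>f. analysis X f = analysis \<Phi> f"
  shows "X = \<Phi>"
proof
  fix i
  show "X i = \<Phi> i"
    by (rule cinner_eqI_right) (metis assms ell2_coeff_analysis)
qed

lemma synthesis_injective:
  fixes \<Phi> X :: "'i \<Rightarrow> 'a::chilbert_space"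
  assumes "is_bessel \<Phi>" "is_bessel X" "\<And>c. synthesis X c = synthesis \<Phi> c"
  shows "X = \<Phi>"
proof (rule analysis_injective[OF assms(1,2)])
  show "analysis X f = analysis \<Phi> f" for f
    by (rule cinner_eqI_left) (simp add: cinner_analysis assms)
qed

lemma ker_synthesis:
  fixes \<Phi> :: "'i \<Rightarrow> 'a::chilbert_space"
  assumes "is_bessel \<Phi>"
  shows "ker (synthesis \<Phi>) = orth_compl (range (analysis \<Phi>))"
proof -
  have "synthesis \<Phi> c = 0 \<longleftrightarrow> (\<forall>f. cinner (synthesis \<Phi> c) f = 0)" for c
    by (metis cinner_self_eq_0_iff cinner_zero_left)
  then show ?thesis
    by (auto simp: ker_def orth_compl_def cinner_synthesis[OF assms])
qed

lemma is_dual_reconstruction: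
  fixes \<Phi> X :: "'i \<Rightarrow> 'a::chilbert_space"
  assumes "is_dual \<Phi> X"
  shows "synthesis \<Phi> (analysis X f) = f"
  using assms by (simp add: is_dual_def synthesis_def ell2_coeff_analysis infsumI)

text \<open>Duality of Bessel sequences is symmetric: the two reconstruction formulas are adjoint to
  each other.\<close>

lemma is_dual_reconstruction':
  fixes \<Phi> X :: "'i \<Rightarrow> 'a::chilbert_space"
  assumes "is_dual \<Phi> X"
  shows "synthesis X (analysis \<Phi> f) = f"
proof (rule cinner_eqI_left)
  fix g
  have b: "is_bessel \<Phi>" "is_bessel X" using assms by (auto simp: is_dual_def)
  show "cinner (synthesis X (analysis \<Phi> f)) g = cinner f g"
    by (simp add: cinner_synthesis[OF b(2)] cinner_analysis[OF b(1)]
        is_dual_reconstruction[OF assms])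
qed


lemma is_dual_sym:
  fixes \<Phi> X :: "'i \<Rightarrow> 'a::chilbert_space"
  assumes "is_dual \<Phi> X"
  shows "is_dual X \<Phi>"
  unfolding is_dual_def
proof (intro conjI allI)
  show b: "is_bessel X" "is_bessel \<Phi>" using assms by (auto simp: is_dual_def)
  fix f
  have "((\<lambda>i. ell2_coeff (analysis \<Phi> f) i *\<^sub>C X i) has_sum synthesis X (analysis \<Phi> f)) UNIV"
    unfolding synthesis_def by (rule has_sum_infsum[OF synthesis_summable[OF b(1)]])
  then show "((\<lambda>i. cinner f (\<Phi> i) *\<^sub>C X i) has_sum f) UNIV"
    by (simp add: ell2_coeff_analysis[OF b(2)] is_dual_reconstruction'[OF assms])
qed


section \<open>The frame operator and the canonical dual\<close>

lemma is_frame_is_bessel: "is_frame \<Phi> \<Longrightarrow> is_bessel \<Phi>"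
  by (simp add: is_frame_def)

lemma cinner_frame_op:
  fixes \<Phi> :: "'i \<Rightarrow> 'a::chilbert_space"
  assumes "is_bessel \<Phi>"
  shows "cinner (frame_op \<Phi> f) g = cinner (analysis \<Phi> f) (analysis \<Phi> g)"
  by (simp add: frame_op_def cinner_synthesis[OF assms])

text \<open>The lower frame bound is precisely coercivity of the frame operator, as
  \<open>\<langle>S f, f\<rangle> = \<parallel>T\<^sup>* f\<parallel>\<^sup>2\<close>.\<close>

lemma invertible_frame_op:
  fixes \<Phi> :: "'i \<Rightarrow> 'a::chilbert_space"
  assumes "is_frame \<Phi>"
  shows "invertible_op (frame_op \<Phi>)"
proof -
  note b = is_frame_is_bessel[OF assms]
  obtain A where A: "A > 0" "\<And>f. A * (norm f)\<^sup>2 \<le> (\<Sum>\<^sub>\<infinity>i. (cmod (cinner f (\<Phi> i)))\<^sup>2)"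
    using assms by (auto simp: is_frame_def)
  show ?thesis
  proof (rule coercive_imp_invertible_op[OF _ A(1)])
    show "bounded_clinear (frame_op \<Phi>)"
      unfolding frame_op_def
      by (intro bounded_clinear_comp bounded_clinear_synthesis bounded_clinear_analysis b)
    show "A * (norm f)\<^sup>2 \<le> Re (cinner (frame_op \<Phi> f) f)" for f
      using A(2)[of f] by (simp add: cinner_frame_op[OF b] cinner_self norm_analysis_sq[OF b])
  qed
qed

lemma cinner_inv_frame_op:
  fixes \<Phi> :: "'i \<Rightarrow> 'a::chilbert_space"
  assumes "is_frame \<Phi>"
  shows "cinner (inv (frame_op \<Phi>) f) g = cinner f (inv (frame_op \<Phi>) g)"
proof -
  let ?S = "frame_op \<Phi>"
  note b = is_frame_is_bessel[OF assms]
  note i = invertible_op_inv[OF invertible_frame_op[OF assms]]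
  have sym: "cinner (?S x) y = cinner x (?S y)" for x y
    by (metis cinner_frame_op[OF b] cinner_commute)
  show ?thesis using sym[of "inv ?S f" "inv ?S g"] by (simp add: i)
qed

lemma cinner_canonical_dual:
  fixes \<Phi> :: "'i \<Rightarrow> 'a::chilbert_space"
  assumes "is_frame \<Phi>"
  shows "cinner f (canonical_dual \<Phi> i) = cinner (inv (frame_op \<Phi>) f) (\<Phi> i)"
  by (simp add: canonical_dual_def cinner_inv_frame_op[OF assms])

lemma is_bessel_canonical_dual:
  fixes \<Phi> :: "'i \<Rightarrow> 'a::chilbert_space"
  assumes "is_frame \<Phi>"
  shows "is_bessel (canonical_dual \<Phi>)"
proof -
  let ?R = "inv (frame_op \<Phi>)"
  obtain B where B: "bessel_bound \<Phi> B"
    using is_frame_is_bessel[OF assms] by (auto simp: is_bessel_def)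
  obtain K where K: "K > 0" "\<And>f. norm (?R f) \<le> norm f * K"
    using bounded_linear.pos_bounded invertible_op_inv(1)[OF invertible_frame_op[OF assms]]
    unfolding bounded_clinear_def by blast
  have "B * (norm (?R f))\<^sup>2 \<le> (B * K\<^sup>2) * (norm f)\<^sup>2" for f
    using power_mono[OF K(2)[of f] norm_ge_zero, of 2] B
    by (auto simp: bessel_bound_def power_mult_distrib mult_ac)
  then have "bessel_bound (canonical_dual \<Phi>) (B * K\<^sup>2)"
    using B K(1) unfolding bessel_bound_def cinner_canonical_dual[OF assms]
    by (auto intro: order_trans)
  then show ?thesis by (auto simp: is_bessel_def)
qed

lemma analysis_canonical_dual:
  fixes \<Phi> :: "'i \<Rightarrow> 'a::chilbert_space"
  assumes "is_frame \<Phi>"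
  shows "analysis (canonical_dual \<Phi>) f = analysis \<Phi> (inv (frame_op \<Phi>) f)"
  by (simp add: analysis_def cinner_canonical_dual[OF assms])

lemma synthesis_canonical_dual:
  fixes \<Phi> :: "'i \<Rightarrow> 'a::chilbert_space"
  assumes "is_frame \<Phi>"
  shows "synthesis (canonical_dual \<Phi>) c = inv (frame_op \<Phi>) (synthesis \<Phi> c)"
proof (rule cinner_eqI_left)
  fix f
  note b = is_frame_is_bessel[OF assms] is_bessel_canonical_dual[OF assms]
  show "cinner (synthesis (canonical_dual \<Phi>) c) f = cinner (inv (frame_op \<Phi>) (synthesis \<Phi> c)) f"
    by (simp only: cinner_synthesis[OF b(1)] cinner_synthesis[OF b(2)]
        analysis_canonical_dual[OF assms] cinner_inv_frame_op[OF assms])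
qed

lemma is_dual_canonical_dual:
  fixes \<Phi> :: "'i \<Rightarrow> 'a::chilbert_space"
  assumes "is_frame \<Phi>"
  shows "is_dual \<Phi> (canonical_dual \<Phi>)"
  unfolding is_dual_def
proof (intro conjI allI)
  note b = is_frame_is_bessel[OF assms] is_bessel_canonical_dual[OF assms]
  show "is_bessel \<Phi>" "is_bessel (canonical_dual \<Phi>)" by (fact b)+
  fix f
  let ?c = "analysis (canonical_dual \<Phi>) f"
  have "((\<lambda>i. ell2_coeff ?c i *\<^sub>C \<Phi> i) has_sum synthesis \<Phi> ?c) UNIV"
    unfolding synthesis_def by (rule has_sum_infsum[OF synthesis_summable[OF b(1)]])
  moreover have "synthesis \<Phi> ?c = f"
    using invertible_op_inv(3)[OF invertible_frame_op[OF assms], of f]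
    by (simp add: analysis_canonical_dual[OF assms] frame_op_def)
  ultimately show "((\<lambda>i. cinner f (canonical_dual \<Phi> i) *\<^sub>C \<Phi> i) has_sum f) UNIV"
    by (simp add: ell2_coeff_analysis[OF b(2)])
qed

lemma ker_synthesis_canonical_dual:
  fixes \<Phi> :: "'i \<Rightarrow> 'a::chilbert_space"
  assumes "is_frame \<Phi>"
  shows "ker (synthesis (canonical_dual \<Phi>)) = ker (synthesis \<Phi>)"
proof -
  note i = invertible_op_inv[OF invertible_frame_op[OF assms]]
  have "inv (frame_op \<Phi>) f = 0 \<longleftrightarrow> f = 0" for f
    by (metis i(3) bounded_clinear_zero[OF i(1)])
  then show ?thesis by (simp add: ker_def synthesis_canonical_dual[OF assms])
qed

text \<open>For a frame, \<open>T\<^sup>* T~\<close> is the orthogonal projection of \<open>\<ell>\<^sup>2\<close> onto the range of \<open>T\<^sup>*\<close>; a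
  sequence orthogonal to \<open>ker T\<close> is fixed by it.\<close>

lemma range_analysis:
  fixes \<Phi> :: "'i \<Rightarrow> 'a::chilbert_space"
  assumes "is_frame \<Phi>"
  shows "range (analysis \<Phi>) = orth_compl (ker (synthesis \<Phi>))"
proof (intro set_eqI iffI)
  note b = is_frame_is_bessel[OF assms] and i = invertible_op_inv[OF invertible_frame_op[OF assms]]
  show "c \<in> orth_compl (ker (synthesis \<Phi>))" if "c \<in> range (analysis \<Phi>)" for c
    using that by (auto simp: orth_compl_def ker_def cinner_analysis[OF b] cinner_zero_right)
  fix c assume c: "c \<in> orth_compl (ker (synthesis \<Phi>))"
  define d where "d = analysis \<Phi> (inv (frame_op \<Phi>) (synthesis \<Phi> c))"
  have "synthesis \<Phi> d = synthesis \<Phi> c"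
    using i(3)[of "synthesis \<Phi> c"] by (simp add: d_def frame_op_def)
  then have k: "synthesis \<Phi> (c - d) = 0"
    by (simp add: bounded_clinear_diff[OF bounded_clinear_synthesis[OF b]])
  then have "cinner c (c - d) = 0" using c by (simp add: orth_compl_def ker_def)
  moreover have "cinner d (c - d) = 0"
    using k by (simp add: d_def cinner_analysis[OF b] cinner_zero_right)
  ultimately have "cinner (c - d) (c - d) = 0" by (simp add: cinner_diff_left)
  then have "c = d" by (simp add: cinner_self_eq_0_iff)
  then show "c \<in> range (analysis \<Phi>)" by (simp add: d_def)
qed

lemma range_analysis_canonical_dual:
  fixes \<Phi> :: "'i \<Rightarrow> 'a::chilbert_space"
  assumes "is_frame \<Phi>"
  shows "range (analysis (canonical_dual \<Phi>)) = range (analysis \<Phi>)"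
proof -
  have "surj (inv (frame_op \<Phi>))"
    using invertible_op_inv(2)[OF invertible_frame_op[OF assms]] by (rule surjI)
  moreover have "analysis (canonical_dual \<Phi>) = analysis \<Phi> \<circ> inv (frame_op \<Phi>)"
    by (simp add: fun_eq_iff analysis_canonical_dual[OF assms])
  ultimately show ?thesis by (metis image_comp)
qed


section \<open>Cross Gram operators of frames\<close>

lemma bounded_clinear_cross_gram:
  fixes \<Phi> :: "'i \<Rightarrow> 'b::chilbert_space" and \<Psi> :: "'i \<Rightarrow> 'a::chilbert_space"
  assumes "is_bessel \<Phi>" "is_bessel \<Psi>" "bounded_clinear U"
  shows "bounded_clinear (cross_gram U \<Phi> \<Psi>)"
  unfolding cross_gram_def
  by (intro bounded_clinear_comp bounded_clinear_synthesis bounded_clinear_analysis assms)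

text \<open>Invertibility of the middle factor, injectivity of the analysis operator and surjectivity
  of the synthesis operator leave the kernel and the range to the outer factors alone.\<close>

lemma
  fixes \<Phi> :: "'i \<Rightarrow> 'b::chilbert_space" and \<Psi> :: "'i \<Rightarrow> 'a::chilbert_space"
  assumes "is_dual \<Phi> X" "is_dual \<Psi> Y" and U: "invertible_op U"
  shows ker_cross_gram: "ker (cross_gram U \<Phi> \<Psi>) = ker (synthesis \<Psi>)"
    and range_cross_gram: "range (cross_gram U \<Phi> \<Psi>) = range (analysis \<Phi>)"
proof -
  note V = invertible_op_inv[OF U]
  have lin: "bounded_clinear (analysis \<Phi>)" "bounded_clinear U"
    using assms(1) U by (auto simp: is_dual_def bounded_clinear_analysis invertible_op_def)
  have "f = 0" if "analysis \<Phi> (U f) = 0" for f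
  proof -
    have "analysis \<Phi> (U f) = analysis \<Phi> (U 0)"
      by (simp add: that bounded_clinear_zero[OF lin(1)] bounded_clinear_zero[OF lin(2)])
    then have "U f = U 0" by (metis is_dual_reconstruction'[OF assms(1)])
    then show ?thesis by (metis V(2))
  qed
  then have "analysis \<Phi> (U f) = 0 \<longleftrightarrow> f = 0" for f
    by (auto simp: bounded_clinear_zero[OF lin(1)] bounded_clinear_zero[OF lin(2)])
  then show "ker (cross_gram U \<Phi> \<Psi>) = ker (synthesis \<Psi>)"
    by (auto simp: ker_def cross_gram_def)
  have "analysis \<Phi> f = cross_gram U \<Phi> \<Psi> (analysis Y (inv U f))" for f
    by (simp add: cross_gram_def is_dual_reconstruction[OF assms(2)] V(3))
  then show "range (cross_gram U \<Phi> \<Psi>) = range (analysis \<Phi>)"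
    by (auto simp: cross_gram_def)
qed

lemma pseudo_inverse_cross_gram:
  fixes \<Phi> :: "'i \<Rightarrow> 'b::chilbert_space" and \<Psi> :: "'i \<Rightarrow> 'a::chilbert_space"
  assumes \<Phi>: "is_frame \<Phi>" and \<Psi>: "is_frame \<Psi>" and U: "invertible_op U"
  shows "pseudo_inverse (cross_gram U \<Phi> \<Psi>)
    = cross_gram (inv U) (canonical_dual \<Psi>) (canonical_dual \<Phi>)"
proof (rule pseudo_inverse_eqI)
  let ?G = "cross_gram U \<Phi> \<Psi>" and ?P = "cross_gram (inv U) (canonical_dual \<Psi>) (canonical_dual \<Phi>)"
  note d\<Phi> = is_dual_canonical_dual[OF \<Phi>] and d\<Psi> = is_dual_canonical_dual[OF \<Psi>]
  note dual' = is_dual_sym[OF d\<Psi>] is_dual_sym[OF d\<Phi>]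
  note V = invertible_op_inv[OF U]
  have U': "bounded_clinear U" using U by (simp add: invertible_op_def)
  show "bounded_clinear ?G"
    by (intro bounded_clinear_cross_gram is_frame_is_bessel \<Phi> \<Psi> U')
  have "bounded_clinear ?P"
    by (intro bounded_clinear_cross_gram is_bessel_canonical_dual \<Phi> \<Psi> V(1))
  moreover have "ker ?P = orth_compl (range ?G)"
    unfolding ker_cross_gram[OF dual' invertible_op_inv_op[OF U]]
      range_cross_gram[OF d\<Phi> d\<Psi> U] ker_synthesis_canonical_dual[OF \<Phi>]
    by (rule ker_synthesis[OF is_frame_is_bessel[OF \<Phi>]])
  moreover have "range ?P = orth_compl (ker ?G)"
    unfolding range_cross_gram[OF dual' invertible_op_inv_op[OF U]]
      ker_cross_gram[OF d\<Phi> d\<Psi> U] range_analysis_canonical_dual[OF \<Psi>]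
    by (rule range_analysis[OF \<Psi>])
  moreover have "?G \<circ> ?P \<circ> ?G = ?G"
  proof
    fix c
    show "(?G \<circ> ?P \<circ> ?G) c = ?G c"
      unfolding cross_gram_def comp_apply is_dual_reconstruction[OF d\<Psi>]
        is_dual_reconstruction'[OF d\<Phi>] V(3) by (rule refl)
  qed
  ultimately show "is_pseudo_inverse ?G ?P" unfolding is_pseudo_inverse_def by (intro conjI)
qed

lemma cross_gram_cancel_left:
  fixes \<Phi> X :: "'i \<Rightarrow> 'a::chilbert_space" and \<Psi> :: "'i \<Rightarrow> 'b::chilbert_space"
  assumes "is_bessel \<Phi>" "is_bessel X" "is_dual \<Psi> Y" "inj V"
    and "cross_gram V \<Psi> X = cross_gram V \<Psi> \<Phi>"
  shows "X = \<Phi>"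
proof (rule synthesis_injective[OF assms(1,2)])
  fix c
  have "analysis \<Psi> (V (synthesis X c)) = analysis \<Psi> (V (synthesis \<Phi> c))"
    using fun_cong[OF assms(5), of c] by (simp add: cross_gram_def)
  from arg_cong[OF this, of "synthesis Y"]
  have "V (synthesis X c) = V (synthesis \<Phi> c)"
    by (simp add: is_dual_reconstruction'[OF assms(3)])
  then show "synthesis X c = synthesis \<Phi> c" using assms(4) by (simp add: inj_eq)
qed

lemma cross_gram_cancel_right:
  fixes \<Phi> X :: "'i \<Rightarrow> 'a::chilbert_space" and \<Psi> :: "'i \<Rightarrow> 'b::chilbert_space"
  assumes "is_bessel \<Phi>" "is_bessel X" "is_dual \<Psi> Y" "surj V"
    and "cross_gram V X \<Psi> = cross_gram V \<Phi> \<Psi>"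
  shows "X = \<Phi>"
proof (rule analysis_injective[OF assms(1,2)])
  fix f
  obtain g where g: "f = V g" using assms(4) by blast
  show "analysis X f = analysis \<Phi> f"
    using fun_cong[OF assms(5), of "analysis Y g"]
    by (simp add: cross_gram_def is_dual_reconstruction[OF assms(3)] g)
qed

theorem theorem4p1:
  fixes \<Phi> \<Psi> :: "'i::countable \<Rightarrow> 'a::chilbert_space" and U :: "'a \<Rightarrow> 'a"
  assumes "separable_space (euclidean :: 'a topology)"
    and "is_frame \<Psi>" and "is_frame \<Phi>"
    and "invertible_op U"
    and "closed (range (cross_gram U \<Phi> \<Psi>))"
  shows "(\<exists>!\<Phi>d. is_dual \<Phi> \<Phi>d \<and>
        pseudo_inverse (cross_gram U \<Phi> \<Psi>) = cross_gram (inv U) (canonical_dual \<Psi>) \<Phi>d) \<and>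
      (\<exists>!\<Psi>d. is_dual \<Psi> \<Psi>d \<and>
        pseudo_inverse (cross_gram U \<Phi> \<Psi>) = cross_gram (inv U) \<Psi>d (canonical_dual \<Phi>))"
proof -
  note \<Psi> = assms(2) and \<Phi> = assms(3) and V = invertible_op_inv[OF assms(4)]
  note d\<Phi> = is_dual_canonical_dual[OF \<Phi>] and d\<Psi> = is_dual_canonical_dual[OF \<Psi>]
  have inj: "inj (inv U)" by (rule inj_on_inverseI) (rule V(3))
  have surj: "surj (inv U)" by (rule surjI) (rule V(2))
  note P = pseudo_inverse_cross_gram[OF \<Phi> \<Psi> assms(4)]
  show ?thesis
    unfolding P
  proof (intro conjI ex1I; (elim conjE)?)
    fix X
    assume X: "is_dual \<Phi> X" and eq: "cross_gram (inv U) (canonical_dual \<Psi>) (canonical_dual \<Phi>)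
      = cross_gram (inv U) (canonical_dual \<Psi>) X"
    show "X = canonical_dual \<Phi>"
    proof (rule cross_gram_cancel_left[OF is_bessel_canonical_dual[OF \<Phi>] _ is_dual_sym[OF d\<Psi>] inj])
      show "is_bessel X" using X unfolding is_dual_def by blast
    qed (rule eq[symmetric])
  next
    fix X
    assume X: "is_dual \<Psi> X" and eq: "cross_gram (inv U) (canonical_dual \<Psi>) (canonical_dual \<Phi>)
      = cross_gram (inv U) X (canonical_dual \<Phi>)"
    show "X = canonical_dual \<Psi>"
    proof (rule cross_gram_cancel_right[OF is_bessel_canonical_dual[OF \<Psi>] _ is_dual_sym[OF d\<Phi>] surj])
      show "is_bessel X" using X unfolding is_dual_def by blast
    qed (rule eq[symmetric])
  qed (rule d\<Phi> d\<Psi> refl)+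
qed

end
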